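(* Let ${\bf d}$ be the metric on $\mathbb{R}^\omega=\prod_{i\in\mathbb{N}}\mathbb{R}$ defined by $${\bf d}(x,y):=\sup_{i\ge1}\frac{\min\{|x_i-y_i|,1\}}{i},\qquad x=(x_i)_{i\in\mathbb{N}},\ y=(y_i)_{i\in\mathbb{N}}\in\mathbb{R}^\omega.$$ Then the spaces $l^p$ ($1\le p\le+\infty$), as subspaces of $(\mathbb{R}^{\omega},{\bf d})$, have the Lebesgue property.
   Context: $\mathbb{N}=\{1,2,\dots\}$; $l^p$ is the usual space of real $p$-summable sequences (bounded sequences if $p=+\infty$), here carrying the subspace topology and metric inherited from $(\mathbb{R}^\omega,{\bf d})$ rather than its Banach norm. The metric ${\bf d}$ on $\mathbb{R}^\omega$ is complete and invariant and induces the product topology. Definitions. Let $X$ be a real vector space equipped with a complete and invariant metric ${\bf d}$, where complete means that every Cauchy sequence in $X$ converges to a point of $X$, and invariant means ${\bf d}(x+z,y+z)={\bf d}(x,y)$ for all $x,y,z\in X$. A tagged partition of $[a,b]$ is $\Delta=\{(s_i,[t_{i-1},t_i]):1\le i\le N\}$ with $a=t_0<t_1<\dots<t_N=b$ and $s_i\in[t_{i-1},t_i]$ for each $i$; write $|\Delta|:=\max_{1\le i\le N}(t_i-t_{i-1})$ and, for $f:[a,b]\to X$, $f(\Delta):=\sum_{i=1}^N(t_i-t_{i-1})f(s_i)$. The function $f:[a,b]\to X$ is Riemann integrable on $[a,b]$ if there is $\bar x\in X$ such that for every $\varepsilon>0$ there is $\delta>0$ with ${\bf d}(f(\Delta),\bar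 x)<\varepsilon$ for every tagged partition $\Delta$ of $[a,b]$ with $|\Delta|<\delta$. The space $X$ has the Lebesgue property if every Riemann integrable function $f:[a,b]\to X$ is continuous almost everywhere on $[a,b]$ (with respect to Lebesgue measure). *)

theory Defs
  imports "HOL-Analysis.Analysis" "HOL-Library.Function_Algebras"
begin

section \<open>Sequences as a real vector space\<close>

text \<open>
  The library provides pointwise addition on functions, but no scalar multiplication.
\<close>

instantiation "fun" :: (type, real_vector) real_vector
begin

definition scaleR_fun :: "real \<Rightarrow> ('a \<Rightarrow> 'b) \<Rightarrow> 'a \<Rightarrow> 'b"
  where "scaleR_fun c f = (\<lambda>x. c *\<^sub>R f x)"

instance
  by standard (simp_all add: scaleR_fun_def fun_eq_iff scaleR_add_left scaleR_add_right)

end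

lemma scaleR_fun_apply [simp]: "(c *\<^sub>R f) x = c *\<^sub>R f x"
  by (simp add: scaleR_fun_def)


section \<open>Riemann integrability in a vector space with a metric\<close>

text \<open>
  The partition points are \<open>t 0, \<dots>, t N\<close> and the tags are \<open>s 1, \<dots>, s N\<close>; the values
  of \<open>t\<close> and \<open>s\<close> at other indices are irrelevant.
\<close>

definition tagged_partition ::
    "real \<Rightarrow> real \<Rightarrow> nat \<Rightarrow> (nat \<Rightarrow> real) \<Rightarrow> (nat \<Rightarrow> real) \<Rightarrow> bool" where
  "tagged_partition a b N t s \<longleftrightarrow>
     1 \<le> N \<and> t 0 = a \<and> t N = b \<and>
     (\<forall>i\<in>{1..N}. t (i - 1) < t i \<and> s i \<in> {t (i - 1)..t i})"

definition mesh :: "nat \<Rightarrow> (nat \<Rightarrow> real) \<Rightarrow> real" where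
  "mesh N t = Max ((\<lambda>i. t i - t (i - 1)) ` {1..N})"

definition riemann_sum ::
    "(real \<Rightarrow> 'a::real_vector) \<Rightarrow> nat \<Rightarrow> (nat \<Rightarrow> real) \<Rightarrow> (nat \<Rightarrow> real) \<Rightarrow> 'a" where
  "riemann_sum f N t s = (\<Sum>i=1..N. (t i - t (i - 1)) *\<^sub>R f (s i))"

text \<open>
  Below, \<open>X\<close> is a linear subspace of the ambient type and \<open>d\<close> restricts to an invariant
  metric on \<open>X\<close>.  The integral is required to lie in \<open>X\<close>.  Completeness of \<open>X\<close> is not
  needed for the definitions to make sense, and the spaces \<open>l\<^sup>p\<close> considered below are not
  complete: they are dense proper subspaces of the space of all sequences.
\<close>

definition riemann_integrable_on ::
    "'a::real_vector set \<Rightarrow> ('a \<Rightarrow> 'a \<Rightarrow> real) \<Rightarrow> (real \<Rightarrow> 'a) \<Rightarrow> real \<Rightarrow> real \<Rightarrow> bool" where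
  "riemann_integrable_on X d f a b \<longleftrightarrow>
     (\<exists>I\<in>X. \<forall>\<epsilon>>0. \<exists>\<delta>>0. \<forall>N t s.
        tagged_partition a b N t s \<and> mesh N t < \<delta> \<longrightarrow> d (riemann_sum f N t s) I < \<epsilon>)"

definition lebesgue_property ::
    "'a::real_vector set \<Rightarrow> ('a \<Rightarrow> 'a \<Rightarrow> real) \<Rightarrow> bool" where
  "lebesgue_property X d \<longleftrightarrow>
     (\<forall>a b. \<forall>f \<in> {a..b} \<rightarrow> X. a < b \<longrightarrow> riemann_integrable_on X d f a b \<longrightarrow>
        (AE x in lebesgue_on {a..b}.
           topcontinuous_at (top_of_set {a..b}) (Metric_space.mtopology X d) f x))"


section \<open>The metric on the space of sequences, and the spaces \<open>l\<^sup>p\<close>\<close>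

text \<open>
  A sequence \<open>(x\<^sub>1, x\<^sub>2, \<dots>)\<close> is represented by \<open>x :: nat \<Rightarrow> real\<close> with \<open>x i\<close> in the role of
  \<open>x\<^sub>i\<^sub>+\<^sub>1\<close>; hence the denominator \<open>Suc i\<close>.
\<close>

definition seq_dist :: "(nat \<Rightarrow> real) \<Rightarrow> (nat \<Rightarrow> real) \<Rightarrow> real" where
  "seq_dist x y = (SUP i. min \<bar>x i - y i\<bar> 1 / real (Suc i))"

definition lp :: "ereal \<Rightarrow> (nat \<Rightarrow> real) set" where
  "lp p = (if p = \<infinity> then {x. bounded (range x)}
           else {x. summable (\<lambda>i. \<bar>x i\<bar> powr real_of_ereal p)})"

lemma seq_dist_bdd: "bdd_above (range (\<lambda>i. min \<bar>x i - y i\<bar> 1 / real (Suc i)))"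
  by (rule bdd_aboveI[of _ 1]) (auto simp: divide_simps)

lemma Metric_space_seq_dist: "Metric_space UNIV seq_dist"
proof
  fix x y z :: "nat \<Rightarrow> real"
  have le: "min \<bar>u i - v i\<bar> 1 / real (Suc i) \<le> seq_dist u v" for u v i
    unfolding seq_dist_def by (rule cSUP_upper[OF _ seq_dist_bdd]) simp
  show nn: "0 \<le> seq_dist x y"
    by (rule order_trans[OF _ le[of x 0 y]]) simp
  show "seq_dist x y = seq_dist y x"
    by (simp add: seq_dist_def abs_minus_commute)
  show "seq_dist x y = 0 \<longleftrightarrow> x = y"
  proof
    assume 0: "seq_dist x y = 0"
    show "x = y"
    proof
      fix i
      have "min \<bar>x i - y i\<bar> 1 \<le> 0"
        using le[of x i y] by (simp add: 0 divide_simps)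
      then show "x i = y i" by linarith
    qed
  qed (simp add: seq_dist_def)
  show "seq_dist x z \<le> seq_dist x y + seq_dist y z"
    unfolding seq_dist_def[of x z]
  proof (rule cSUP_least)
    fix i
    have "min \<bar>x i - z i\<bar> 1 \<le> min \<bar>x i - y i\<bar> 1 + min \<bar>y i - z i\<bar> 1" by linarith
    then have "min \<bar>x i - z i\<bar> 1 / real (Suc i)
        \<le> min \<bar>x i - y i\<bar> 1 / real (Suc i) + min \<bar>y i - z i\<bar> 1 / real (Suc i)"
      by (simp only: add_divide_distrib[symmetric]) (simp add: divide_right_mono)
    then show "min \<bar>x i - z i\<bar> 1 / real (Suc i) \<le> seq_dist x y + seq_dist y z"
      using le[of x i y] le[of y i z] by linarith
  qed simp
qed

lemma seq_dist_invariant: "seq_dist (x + z) (y + z) = seq_dist x y"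
  by (simp add: seq_dist_def)

lemma subspace_lp:
  assumes "1 \<le> p"
  shows "subspace (lp p)"
proof (cases "p = \<infinity>")
  case True
  show ?thesis
    unfolding True lp_def subspace_def bounded_iff
  proof (simp, intro conjI allI impI)
    show "\<exists>a::real. 0 \<le> a" by (rule exI[of _ 0]) simp
  next
    fix x y :: "nat \<Rightarrow> real"
    assume "\<exists>a. \<forall>i. \<bar>x i\<bar> \<le> a" "\<exists>a. \<forall>i. \<bar>y i\<bar> \<le> a"
    then obtain a b where "\<forall>i. \<bar>x i\<bar> \<le> a" "\<forall>i. \<bar>y i\<bar> \<le> b" by blast
    then have "\<forall>i. \<bar>x i + y i\<bar> \<le> a + b" by (meson abs_triangle_ineq add_mono order_trans)
    then show "\<exists>a. \<forall>i. \<bar>x i + y i\<bar> \<le> a" ..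
  next
    fix c :: real and x :: "nat \<Rightarrow> real"
    assume "\<exists>a. \<forall>i. \<bar>x i\<bar> \<le> a"
    then obtain a where "\<forall>i. \<bar>x i\<bar> \<le> a" by blast
    then have "\<forall>i. \<bar>c * x i\<bar> \<le> \<bar>c\<bar> * a" by (simp add: abs_mult mult_left_mono)
    then show "\<exists>a. \<forall>i. \<bar>c * x i\<bar> \<le> a" ..
  qed
next
  case False
  define q where "q = real_of_ereal p"
  have q: "1 \<le> q"
    using assms False unfolding q_def by (cases p) (auto simp: one_ereal_def)
  have lp: "lp p = {x. summable (\<lambda>i. \<bar>x i\<bar> powr q)}"
    using False by (simp add: lp_def q_def)
  show ?thesis
    unfolding lp subspace_def
  proof (simp, intro conjI allI impI)
    fix x y :: "nat \<Rightarrow> real"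
    assume x: "summable (\<lambda>i. \<bar>x i\<bar> powr q)" and y: "summable (\<lambda>i. \<bar>y i\<bar> powr q)"
    have le: "\<bar>u + v\<bar> powr q \<le> 2 powr q * (\<bar>u\<bar> powr q + \<bar>v\<bar> powr q)" for u v :: real
    proof -
      have "\<bar>u + v\<bar> powr q \<le> (2 * max \<bar>u\<bar> \<bar>v\<bar>) powr q"
        using q by (intro powr_mono2) auto
      also have "\<dots> = 2 powr q * max \<bar>u\<bar> \<bar>v\<bar> powr q"
        by (simp add: powr_mult)
      also have "\<dots> \<le> 2 powr q * (\<bar>u\<bar> powr q + \<bar>v\<bar> powr q)"
        by (intro mult_left_mono) (auto simp: max_def)
      finally show ?thesis .
    qed
    show "summable (\<lambda>i. \<bar>x i + y i\<bar> powr q)"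
      by (rule summable_comparison_test'[OF summable_mult[OF summable_add[OF x y]], of 0 _ "2 powr q"])
        (use le in simp)
  next
    fix c :: real and x :: "nat \<Rightarrow> real"
    assume "summable (\<lambda>i. \<bar>x i\<bar> powr q)"
    then show "summable (\<lambda>i. \<bar>c * x i\<bar> powr q)"
      by (simp add: abs_mult powr_mult summable_mult)
  qed
qed

end

theory Submission
  imports Defs
begin

text \<open>
  The coordinates of a Riemann integrable function are Riemann integrable real functions, and the
  topology of \<open>lp p\<close> is that of coordinatewise convergence, so, a countable union of null sets being
  null, it suffices to prove the necessity half of Lebesgue's criterion for real functions.
  The points of \<open>[a, b]\<close> at which a real function oscillates by at least \<open>e\<close> are, up to finitely
  many, interior to the cells of a fine partition on which two tags can be chosen with values
  \<open>e\<close> apart; comparing the two resulting Riemann sums bounds the total length of these cells.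
\<close>

section \<open>Divisions of an interval and discontinuities of real functions\<close>

lemma mesh_less_iff:
  assumes "1 \<le> N"
  shows "mesh N t < \<delta> \<longleftrightarrow> (\<forall>i\<in>{1..N}. t i - t (i - 1) < \<delta>)"
  unfolding mesh_def using assms by (subst Max_less_iff) auto

lemma ex_fine_division:
  fixes a b \<delta> :: real
  assumes "a < b" "0 < \<delta>"
  obtains N t where "1 \<le> N" "t 0 = a" "t N = b" "\<And>i. i \<in> {1..N} \<Longrightarrow> t (i - 1) < t i" "mesh N t < \<delta>"
proof -
  obtain n :: nat where n: "(b - a) / \<delta> < real n"
    using reals_Archimedean2 by blast
  define t where "t = (\<lambda>i::nat. a + real i * ((b - a) / real n))"
  have n0: "0 < n"
    using n assms by (metis diff_gt_0_iff_gt divide_pos_pos less_trans of_nat_0_less_iff)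
  have step: "t i - t (i - 1) = (b - a) / real n" if "i \<in> {1..n}" for i
    using that by (simp add: t_def of_nat_diff left_diff_distrib diff_divide_distrib)
  show ?thesis
  proof
    show "1 \<le> n" "t 0 = a" "t n = b"
      using n0 by (auto simp: t_def)
    show "t (i - 1) < t i" if "i \<in> {1..n}" for i
    proof -
      have "0 < (b - a) / real n" using assms n0 by simp
      then show ?thesis using step[OF that] by linarith
    qed
    have "(b - a) / real n < \<delta>"
      using n n0 assms by (simp add: field_simps)
    then show "mesh n t < \<delta>"
      using \<open>1 \<le> n\<close> step by (simp add: mesh_less_iff)
  qed
qed

text \<open>Induction on \<open>N\<close>: a point to the left of \<open>t N\<close> falls under the
  induction hypothesis, and a point to the right of it lies in the new last cell. Excluding the
  division points is what makes the open cells suffice.\<close>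

lemma division_cover:
  fixes t :: "nat \<Rightarrow> real"
  assumes "x \<in> {t 0..t N}" "\<And>i. x \<noteq> t i"
  shows "\<exists>i\<in>{1..N}. x \<in> {t (i - 1)<..<t i}"
  using assms
proof (induction N)
  case 0
  then show ?case by (metis atLeastAtMost_singleton singletonD)
next
  case (Suc N)
  show ?case
  proof (cases "x < t N")
    case True
    then obtain i where "i \<in> {1..N}" "x \<in> {t (i - 1)<..<t i}"
      using Suc by auto
    then show ?thesis by (intro bexI[of _ i]) auto
  next
    case False
    then have "x \<in> {t (Suc N - 1)<..<t (Suc N)}"
      using Suc.prems(1) Suc.prems(2)[of N] Suc.prems(2)[of "Suc N"] by auto
    then show ?thesis by (intro bexI[of _ "Suc N"]) auto
  qed
qed

text \<open>The set is covered by the countably many \<open>D e\<close> with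
  \<open>e = 1 / (n + 1)\<close>, and each \<open>D e\<close> lies in measurable sets of arbitrarily
  small measure.\<close>

lemma negligible_discontinuities:
  fixes g :: "real \<Rightarrow> real"
  assumes "a < b" and int: "riemann_integrable_on UNIV dist g a b"
  shows "negligible {x \<in> {a..b}. \<not> continuous (at x within {a..b}) g}"
proof -
  \<comment> \<open>Failure of the epsilon-delta condition at \<open>x\<close> for the tolerance
    \<open>e\<close>. Oscillation is measured against \<open>g x\<close> itself, so that
    \<open>x\<close> can serve as one of the two tags.\<close>
  define D where "D = (\<lambda>e. {x \<in> {a..b}. \<forall>d>0. \<exists>y\<in>{a..b}. dist y x < d \<and> e \<le> dist (g y) (g x)})"
  have neg: "negligible (D e)" if e: "0 < e" for e
    unfolding negligible_outer_le
  proof (intro allI impI)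
    fix \<eta> :: real assume \<eta>: "0 < \<eta>"
    obtain I where "\<forall>\<epsilon>>0. \<exists>\<delta>>0. \<forall>N t s.
        tagged_partition a b N t s \<and> mesh N t < \<delta> \<longrightarrow> dist (riemann_sum g N t s) I < \<epsilon>"
      using int by (auto simp: riemann_integrable_on_def)
    \<comment> \<open>Two Riemann sums this close to \<open>I\<close> differ by at most
      \<open>e * \<eta>\<close>; division by \<open>e\<close> then leaves \<open>\<eta>\<close> for
      the total length of the cells in \<open>B\<close>.\<close>
    moreover have "0 < e * \<eta> / 2" using e \<eta> by simp
    ultimately obtain \<delta> where \<delta>: "0 < \<delta>" and close: "\<And>N t s. tagged_partition a b N t s \<Longrightarrow>
        mesh N t < \<delta> \<Longrightarrow> dist (riemann_sum g N t s) I < e * \<eta> / 2"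
      by metis
    obtain N t where N: "1 \<le> N" and t: "t 0 = a" "t N = b"
      and lt: "\<And>i. i \<in> {1..N} \<Longrightarrow> t (i - 1) < t i" and mesh: "mesh N t < \<delta>"
      using ex_fine_division[OF \<open>a < b\<close> \<delta>] by metis
    define B where "B = {i \<in> {1..N}. \<exists>u v. u \<in> {t (i - 1)..t i} \<and> v \<in> {t (i - 1)..t i} \<and> e \<le> g u - g v}"
    \<comment> \<open>Outside \<open>B\<close> both tags may be put at \<open>t i\<close>. Only a
      nonnegative difference is recorded there, which is enough for bounding the difference of the
      sums from below.\<close>
    have "\<exists>u v. u \<in> {t (i - 1)..t i} \<and> v \<in> {t (i - 1)..t i} \<and> (if i \<in> B then e else 0) \<le> g u - g v"
      if "i \<in> {1..N}" for i
    proof (cases "i \<in> B")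
      case False
      then show ?thesis using lt[OF that] by (intro exI[of _ "t i"]) auto
    qed (auto simp: B_def)
    then obtain u v where uv: "\<And>i. i \<in> {1..N} \<Longrightarrow> u i \<in> {t (i - 1)..t i} \<and> v i \<in> {t (i - 1)..t i} \<and>
        (if i \<in> B then e else 0) \<le> g (u i) - g (v i)"
      by metis
    have "B \<subseteq> {1..N}" by (auto simp: B_def)
    then have finB: "finite B" by (rule finite_subset) simp
    have "e * (\<Sum>i\<in>B. t i - t (i - 1)) = (\<Sum>i=1..N. (t i - t (i - 1)) * (if i \<in> B then e else 0))"
      using \<open>B \<subseteq> {1..N}\<close>
      by (simp add: sum_distrib_left mult.commute if_distrib sum.If_cases Int_absorb1 cong: if_cong)
    also have "\<dots> \<le> (\<Sum>i=1..N. (t i - t (i - 1)) * (g (u i) - g (v i)))"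
      using uv lt by (intro sum_mono mult_left_mono) (auto intro: less_imp_le)
    also have "\<dots> = riemann_sum g N t u - riemann_sum g N t v"
      by (simp add: riemann_sum_def right_diff_distrib sum_subtractf)
    also have "\<dots> \<le> e * \<eta>"
    proof -
      have "tagged_partition a b N t u" "tagged_partition a b N t v"
        using N t lt uv by (auto simp: tagged_partition_def)
      then show ?thesis
        using close[of N t u] close[of N t v] mesh by (simp add: dist_real_def abs_if split: if_splits)
    qed
    finally have len: "(\<Sum>i\<in>B. t i - t (i - 1)) \<le> \<eta>" using e by simp
    \<comment> \<open>The division points are added because a point of \<open>D e\<close> is known
      to mark its cell as one of \<open>B\<close> only if it is interior to the cell; being finitely
      many, they add no measure.\<close>
    define T where "T = (\<Union>i\<in>B. {t (i - 1)..t i}) \<union> t ` {..N}"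
    show "\<exists>T. D e \<subseteq> T \<and> T \<in> lmeasurable \<and> measure lebesgue T \<le> \<eta>"
    proof (intro exI[of _ T] conjI subsetI)
      fix x assume x: "x \<in> D e"
      show "x \<in> T"
      proof (cases "x \<in> t ` {..N}")
        case False
        \<comment> \<open>Values of \<open>t\<close> beyond \<open>N\<close> are arbitrary and could
          hit \<open>x\<close>; freezing the sequence at \<open>t N\<close> lets
          \<open>division_cover\<close> apply.\<close>
        define t' where "t' = (\<lambda>i. t (min i N))"
        have "\<exists>i\<in>{1..N}. x \<in> {t' (i - 1)<..<t' i}"
          using x False by (intro division_cover) (auto simp: D_def t'_def t)
        then obtain i where i: "i \<in> {1..N}" and xi: "x \<in> {t (i - 1)<..<t i}"
          by (auto simp: t'_def min_def split: if_splits)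
        \<comment> \<open>The ball keeps the witness \<open>y\<close> in the same cell as
          \<open>x\<close>; whichever of \<open>g x\<close> and \<open>g y\<close> is larger, the
          two points put \<open>i\<close> into \<open>B\<close>.\<close>
        obtain d where d: "0 < d" "ball x d \<subseteq> {t (i - 1)<..<t i}"
          using xi by (meson open_contains_ball open_greaterThanLessThan)
        then obtain y where y: "dist y x < d" "e \<le> dist (g y) (g x)"
          using x by (auto simp: D_def)
        have "y \<in> {t (i - 1)<..<t i}"
          using d y by (auto simp: dist_commute)
        then have "y \<in> {t (i - 1)..t i}" "x \<in> {t (i - 1)..t i}"
          using xi by auto
        moreover have "e \<le> g y - g x \<or> e \<le> g x - g y"
          using y(2) by (auto simp: dist_real_def)
        ultimately have "i \<in> B"
          using i unfolding B_def by blast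
        then show ?thesis using xi by (force simp: T_def)
      qed (simp add: T_def)
    next
      have null: "t ` {..N} \<in> null_sets lebesgue"
        by (simp add: finite_imp_null_set_lborel null_sets_completionI)
      have meas: "(\<Union>i\<in>B. {t (i - 1)..t i}) \<in> lmeasurable"
        using finB by (intro fmeasurable.finite_UN) auto
      show "T \<in> lmeasurable"
        unfolding T_def using meas null by (intro fmeasurable.Un) (auto intro: fmeasurableI_null_sets)
      have "measure lebesgue T = measure lebesgue (\<Union>i\<in>B. {t (i - 1)..t i})"
        unfolding T_def using null meas by (intro measure_Un_null_set) auto
      also have "\<dots> \<le> (\<Sum>i\<in>B. measure lebesgue {t (i - 1)..t i})"
        using finB by (intro measure_UNION_le) auto
      also have "\<dots> = (\<Sum>i\<in>B. t i - t (i - 1))"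
        using lt \<open>B \<subseteq> {1..N}\<close> by (intro sum.cong) (auto intro!: less_imp_le)
      finally show "measure lebesgue T \<le> \<eta>" using len by simp
    qed
  qed
  have "{x \<in> {a..b}. \<not> continuous (at x within {a..b}) g} \<subseteq> (\<Union>n. D (inverse (real (Suc n))))"
  proof
    fix x assume "x \<in> {x \<in> {a..b}. \<not> continuous (at x within {a..b}) g}"
    then obtain e where x: "x \<in> {a..b}" and "0 < e"
      and far: "\<forall>d>0. \<exists>y\<in>{a..b}. dist y x < d \<and> \<not> dist (g y) (g x) < e"
      unfolding continuous_within_eps_delta by blast
    obtain n where "inverse (real (Suc n)) < e"
      using reals_Archimedean[OF \<open>0 < e\<close>] by blast
    then have "\<forall>d>0. \<exists>y\<in>{a..b}. dist y x < d \<and> inverse (real (Suc n)) \<le> dist (g y) (g x)"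
      using far by (meson less_le_trans linorder_not_le order.strict_implies_order order_le_less_trans)
    then show "x \<in> (\<Union>n. D (inverse (real (Suc n))))"
      using x by (auto simp: D_def)
  qed
  moreover have "negligible (\<Union>n. D (inverse (real (Suc n))))"
    by (intro negligible_countable_Union) (auto intro: neg)
  ultimately show ?thesis by (rule negligible_subset[rotated])
qed

section \<open>From coordinates to sequences\<close>

lemma riemann_sum_apply:
  fixes f :: "real \<Rightarrow> nat \<Rightarrow> real"
  shows "riemann_sum f N t s i = riemann_sum (\<lambda>x. f x i) N t s"
proof -
  have "(\<Sum>j\<in>A. h j) i = (\<Sum>j\<in>A. h j i)" for A :: "nat set" and h :: "nat \<Rightarrow> nat \<Rightarrow> real"
    by (induction A rule: infinite_finite_induct) auto
  then show ?thesis by (simp add: riemann_sum_def)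
qed

lemma coord_le_seq_dist: "min \<bar>x i - y i\<bar> 1 / real (Suc i) \<le> seq_dist x y"
  unfolding seq_dist_def by (rule cSUP_upper[OF _ seq_dist_bdd]) simp

text \<open>Multiplying by \<open>Suc i\<close> removes the weight of the coordinate, and for
  \<open>\<epsilon> \<le> 1\<close> a truncated distance below \<open>\<epsilon>\<close> is the true
  distance.\<close>

lemma dist_coord_less:
  assumes "0 < \<epsilon>" "\<epsilon> \<le> 1" "seq_dist x y < \<epsilon> / real (Suc i)"
  shows "dist (x i) (y i) < \<epsilon>"
proof -
  have "min \<bar>x i - y i\<bar> 1 / real (Suc i) < \<epsilon> / real (Suc i)"
    using coord_le_seq_dist assms(3) by (rule le_less_trans)
  then have "min \<bar>x i - y i\<bar> 1 < \<epsilon>"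
    by (simp add: divide_less_cancel)
  then show ?thesis using assms by (auto simp: dist_real_def)
qed

text \<open>The integral of the \<open>i\<close>-th coordinate is the \<open>i\<close>-th coordinate
  of \<open>I\<close>.\<close>

lemma riemann_integrable_on_coord:
  assumes "riemann_integrable_on X seq_dist f a b"
  shows "riemann_integrable_on UNIV dist (\<lambda>x. f x i) a b"
proof -
  obtain I where I: "\<And>\<epsilon>. 0 < \<epsilon> \<Longrightarrow> \<exists>\<delta>>0. \<forall>N t s.
        tagged_partition a b N t s \<and> mesh N t < \<delta> \<longrightarrow> seq_dist (riemann_sum f N t s) I < \<epsilon>"
    using assms unfolding riemann_integrable_on_def by blast
  have "\<exists>\<delta>>0. \<forall>N t s. tagged_partition a b N t s \<and> mesh N t < \<delta> \<longrightarrow>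
      dist (riemann_sum (\<lambda>x. f x i) N t s) (I i) < \<epsilon>" if "0 < \<epsilon>" for \<epsilon>
  proof -
    \<comment> \<open>The cap at 1 stays within the range where truncation in
      \<open>seq_dist\<close> is invisible.\<close>
    define \<epsilon>' where "\<epsilon>' = min \<epsilon> 1"
    have \<epsilon>': "0 < \<epsilon>'" "\<epsilon>' \<le> 1" "\<epsilon>' \<le> \<epsilon>" using that by (auto simp: \<epsilon>'_def)
    then have "0 < \<epsilon>' / real (Suc i)" by simp
    from I[OF this] \<epsilon>' show ?thesis
      unfolding riemann_sum_apply[symmetric] by (meson dist_coord_less less_le_trans)
  qed
  then show ?thesis unfolding riemann_integrable_on_def by blast
qed

text \<open>Coordinates beyond \<open>n\<close> contribute at most \<open>1 / (n + 1)\<close> to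
  \<open>seq_dist\<close>, whatever their values, so near \<open>x\<close> only finitely many
  coordinates have to be controlled.\<close>

lemma topcontinuous_at_seq_dist:
  fixes f :: "real \<Rightarrow> nat \<Rightarrow> real"
  assumes f: "f \<in> S \<rightarrow> X" and x: "x \<in> S"
    and cont: "\<And>i. continuous (at x within S) (\<lambda>x. f x i)"
  shows "topcontinuous_at (top_of_set S) (Metric_space.mtopology X seq_dist) f x"
proof -
  interpret Metric_space X seq_dist
    by (rule Metric_space.subspace[OF Metric_space_seq_dist]) simp
  have "\<exists>U. openin (top_of_set S) U \<and> x \<in> U \<and> (\<forall>y\<in>U. f y \<in> V)"
    if V': "openin mtopology V" "f x \<in> V" for V
  proof -
    obtain r where r: "0 < r" and V: "mball (f x) r \<subseteq> V"
      using V' unfolding openin_mtopology by blast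
    obtain n where n: "inverse (real (Suc n)) < r"
      using reals_Archimedean[OF r] by blast
    \<comment> \<open>With \<open>r / 2\<close> in place of \<open>r\<close>, all terms have a
      common bound strictly below \<open>r\<close>, and so does their supremum.\<close>
    have "\<forall>\<^sub>F y in at x within S. dist (f y i) (f x i) < r / 2" for i
      using cont[of i] r unfolding continuous_within by (intro tendstoD) auto
    then have "\<forall>\<^sub>F y in at x within S. \<forall>i\<in>{..n}. dist (f y i) (f x i) < r / 2"
      by (intro eventually_ball_finite) auto
    then obtain U where U: "open U" "x \<in> U"
      and close: "\<And>y i. y \<in> U \<Longrightarrow> y \<in> S \<Longrightarrow> y \<noteq> x \<Longrightarrow> i \<le> n \<Longrightarrow> dist (f y i) (f x i) < r / 2"
      by (auto simp: eventually_at_topological)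
    have "f y \<in> V" if y: "y \<in> S" "y \<in> U" for y
    proof -
      have "min \<bar>f x i - f y i\<bar> 1 / real (Suc i) \<le> max (r / 2) (inverse (real (Suc n)))" for i
      proof (cases "i \<le> n")
        case True
        have "dist (f y i) (f x i) < r / 2"
          using close[of y i] y True r by (cases "y = x") auto
        then have "min \<bar>f x i - f y i\<bar> 1 \<le> r / 2"
          unfolding dist_real_def by linarith
        moreover have "min \<bar>f x i - f y i\<bar> 1 / real (Suc i) \<le> min \<bar>f x i - f y i\<bar> 1 / 1"
          by (intro divide_left_mono) auto
        ultimately show ?thesis unfolding div_by_1 by linarith
      next
        case False
        then have "min \<bar>f x i - f y i\<bar> 1 / real (Suc i) \<le> 1 / real (Suc n)"
          by (intro frac_le) auto
        then show ?thesis by (simp add: inverse_eq_divide)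
      qed
      then have "seq_dist (f x) (f y) \<le> max (r / 2) (inverse (real (Suc n)))"
        unfolding seq_dist_def by (intro cSUP_least) auto
      also have "\<dots> < r" using r n by simp
      finally have "f y \<in> mball (f x) r"
        using f x y by auto
      then show ?thesis using V by blast
    qed
    then show ?thesis
      using U x by (intro exI[of _ "S \<inter> U"]) auto
  qed
  then show ?thesis
    using f x by (auto simp: topcontinuous_at_def)
qed

text \<open>Outside the null set formed by the union of all \<open>D i\<close>, every coordinate of
  \<open>f\<close> is continuous, and hence \<open>f\<close> is.\<close>

lemma lebesgue_property_seq_dist: "lebesgue_property X seq_dist"
  unfolding lebesgue_property_def
proof (intro allI ballI impI)
  fix a b :: real and f
  assume f: "f \<in> {a..b} \<rightarrow> X" and "a < b" and int: "riemann_integrable_on X seq_dist f a b"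
  define D where "D = (\<lambda>i. {x \<in> {a..b}. \<not> continuous (at x within {a..b}) (\<lambda>x. f x i)})"
  have "negligible (D i)" for i
    unfolding D_def using \<open>a < b\<close> riemann_integrable_on_coord[OF int]
    by (rule negligible_discontinuities)
  then have "negligible (\<Union>i. D i)"
    by (intro negligible_countable_Union) auto
  then have "AE x in lebesgue. x \<notin> (\<Union>i. D i)"
    by (intro AE_not_in) (simp only: negligible_iff_null_sets)
  then have "AE x in lebesgue. x \<in> {a..b} \<longrightarrow>
      topcontinuous_at (top_of_set {a..b}) (Metric_space.mtopology X seq_dist) f x"
    by eventually_elim (auto simp: D_def intro!: topcontinuous_at_seq_dist f)
  then show "AE x in lebesgue_on {a..b}.
      topcontinuous_at (top_of_set {a..b}) (Metric_space.mtopology X seq_dist) f x"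
    by (subst AE_restrict_space_iff) auto
qed

theorem corollary3p2:
  fixes p :: ereal
  assumes "1 \<le> p"
  shows "lebesgue_property (lp p) seq_dist"
  by (rule lebesgue_property_seq_dist)

end
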